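(* Let $X$ be a $T_1$ space. Then the free paratopological group $\mathit{FP}(X)$ contains as a closed subspace a homeomorphic copy of the product space $X^n$ for each $n\ge 1$.
   Context: A paratopological group is a group $G$ with a topology such that multiplication $G\times G\to G$ is continuous. (Inversion need not be continuous, and no separation axiom is assumed.) For a topological space $X$, the (Markov) free paratopological group $\mathit{FP}(X)$ on $X$ is a paratopological group that contains $X$ as a topological subspace, is generated algebraically by $X$, and is such that every continuous map $f:X\to H$ into an arbitrary paratopological group $H$ extends to a continuous homomorphism $\hat f:\mathit{FP}(X)\to H$. It exists for every space $X$, and its underlying abstract group is the free group on the set $X$. *)

theory Defs
  imports "HOL-Analysis.Analysis" "HOL-Algebra.Generated_Groups" "HOL-Algebra.Product_Groups"
begin

locale paratopological_group = group G for G (structure) +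
  fixes T :: "'g topology"
  assumes topspace_eq: "topspace T = carrier G"
    and continuous_mult: "continuous_map (prod_topology T T) T (\<lambda>(x, y). x \<otimes> y)"

text \<open>
  The (Markov) free paratopological group on \<open>X\<close>, as a predicate on a group \<open>G\<close> with topology \<open>T\<close>
  and an embedding \<open>i\<close> of \<open>X\<close>; literal containment is the case \<open>i = id\<close>.

  A definition cannot quantify over all types, so the test groups \<open>H\<close> have their elements
  in the type of words over \<open>X\<close> and formal inverses. This is no restriction: the subgroup of an
  arbitrary \<open>H\<close> generated by the image of \<open>X\<close> has an isomorphic copy in that type, and
  \<open>free_paratopological_group_extension\<close> below gives the extension property for \<open>H\<close> over any type.
\<close>

definition free_paratopological_group ::
    "'a topology \<Rightarrow> ('g, 'm) monoid_scheme \<Rightarrow> 'g topology \<Rightarrow> ('a \<Rightarrow> 'g) \<Rightarrow> bool" where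
  "free_paratopological_group X G T i \<longleftrightarrow>
     paratopological_group G T \<and>
     embedding_map X T i \<and>
     generate G (i ` topspace X) = carrier G \<and>
     (\<forall>(H :: ('a \<times> bool) list monoid) S f.
        paratopological_group H S \<and> continuous_map X S f \<longrightarrow>
        (\<exists>h \<in> hom G H. continuous_map T S h \<and> (\<forall>x \<in> topspace X. h (i x) = f x)))"

lemma paratopological_group_subgroup:
  assumes "paratopological_group G T" "subgroup K G"
  shows "paratopological_group (G\<lparr>carrier := K\<rparr>) (subtopology T K)"
proof -
  interpret paratopological_group G T by fact
  interpret K: subgroup K G by fact
  show ?thesis
  proof (intro paratopological_group.intro paratopological_group_axioms.intro)
    show "group (G\<lparr>carrier := K\<rparr>)"
      using assms(2) subgroup_imp_group by blast
    show "topspace (subtopology T K) = carrier (G\<lparr>carrier := K\<rparr>)"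
      using K.subset topspace_eq by auto
    have "continuous_map (subtopology (prod_topology T T) (K \<times> K)) T (\<lambda>(x, y). x \<otimes>\<^bsub>G\<^esub> y)"
      using continuous_mult continuous_map_from_subtopology by blast
    then show "continuous_map (prod_topology (subtopology T K) (subtopology T K)) (subtopology T K)
        (\<lambda>(x, y). x \<otimes>\<^bsub>G\<lparr>carrier := K\<rparr>\<^esub> y)"
      by (auto simp: continuous_map_in_subtopology subtopology_Times)
  qed
qed

lemma paratopological_group_transport:
  fixes A :: "'b set"
  assumes "paratopological_group H S" and p: "bij_betw p A (carrier H)"
  obtains K :: "'b monoid" where
    "paratopological_group K (pullback_topology A p S)" "carrier K = A" "p \<in> iso K H"
proof -
  interpret paratopological_group H S by fact
  define q where "q = the_inv_into A p"
  define K :: "'b monoid" where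
    "K = \<lparr>carrier = A, monoid.mult = \<lambda>u v. q (p u \<otimes>\<^bsub>H\<^esub> p v), one = q \<one>\<^bsub>H\<^esub>\<rparr>"
  have pA: "p u \<in> carrier H" if "u \<in> A" for u
    using p that by (auto simp: bij_betw_def)
  have qp: "q (p u) = u" if "u \<in> A" for u
    using p that by (simp add: q_def bij_betw_def the_inv_into_f_f)
  have pq: "p (q x) = x" if "x \<in> carrier H" for x
    using p that by (simp add: q_def bij_betw_def f_the_inv_into_f)
  have qA: "q x \<in> A" if "x \<in> carrier H" for x
    using p that unfolding q_def by (metis bij_betw_def order_refl the_inv_into_into)
  have "group K"
  proof (rule groupI)
    fix u assume "u \<in> carrier K"
    then show "\<exists>v\<in>carrier K. v \<otimes>\<^bsub>K\<^esub> u = \<one>\<^bsub>K\<^esub>"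
      by (intro bexI[of _ "q (inv\<^bsub>H\<^esub> (p u))"]) (auto simp: K_def pA pq qA)
  qed (auto simp: K_def pA pq qA qp m_assoc)
  moreover have "topspace (pullback_topology A p S) = carrier K"
    using pA by (auto simp: topspace_pullback_topology K_def topspace_eq)
  moreover have "continuous_map (prod_topology (pullback_topology A p S) (pullback_topology A p S))
      (pullback_topology A p S) (\<lambda>(u, v). u \<otimes>\<^bsub>K\<^esub> v)"
  proof (rule continuous_map_pullback')
    let ?P = "pullback_topology A p S"
    have c: "continuous_map ?P S p"
      using continuous_map_pullback[OF continuous_map_id, of A p S] by simp
    have "continuous_map (prod_topology ?P ?P) (prod_topology S S) (\<lambda>z. (p (fst z), p (snd z)))"
      using continuous_map_compose[OF continuous_map_fst c] continuous_map_compose[OF continuous_map_snd c]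
      by (intro continuous_map_pairedI) (simp_all add: o_def)
    from continuous_map_compose[OF this continuous_mult]
    have "continuous_map (prod_topology ?P ?P) S (\<lambda>z. p (fst z) \<otimes>\<^bsub>H\<^esub> p (snd z))"
      by (simp add: o_def)
    then show "continuous_map (prod_topology ?P ?P) S (p \<circ> (\<lambda>(u, v). u \<otimes>\<^bsub>K\<^esub> v))"
      by (rule continuous_map_eq) (auto simp: topspace_pullback_topology K_def pA pq)
    show "topspace (prod_topology ?P ?P) \<subseteq> (\<lambda>(u, v). u \<otimes>\<^bsub>K\<^esub> v) -` A"
      by (auto simp: topspace_pullback_topology K_def pA qA)
  qed
  ultimately have "paratopological_group K (pullback_topology A p S)"
    by (simp add: paratopological_group_def paratopological_group_axioms_def)
  moreover have "p \<in> iso K H"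
    using p by (auto simp: iso_def hom_def K_def pA pq)
  ultimately show thesis
    using that by (simp add: K_def)
qed

lemma generate_embeds_in_words:
  assumes "group H" and f: "f ` X \<subseteq> carrier H"
  obtains e :: "'h \<Rightarrow> ('a \<times> bool) list" where "inj_on e (generate H (f ` (X :: 'a set)))"
proof -
  interpret group H by fact
  define ev where "ev = (\<lambda>w. foldr (\<lambda>(x, b) g. (if b then f x else inv\<^bsub>H\<^esub> f x) \<otimes>\<^bsub>H\<^esub> g) w \<one>\<^bsub>H\<^esub>)"
  have ev_simps: "ev [] = \<one>\<^bsub>H\<^esub>"
    "ev ((x, b) # w) = (if b then f x else inv\<^bsub>H\<^esub> f x) \<otimes>\<^bsub>H\<^esub> ev w" for x b w
    by (auto simp: ev_def)
  let ?W = "lists (X \<times> UNIV)"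
  have closed: "ev w \<in> carrier H" if "w \<in> ?W" for w
    using that by (induction w) (use f in \<open>auto simp: ev_simps\<close>)
  have app: "ev (v @ w) = ev v \<otimes>\<^bsub>H\<^esub> ev w" if "v \<in> ?W" "w \<in> ?W" for v w
    using that
  proof (induction v)
    case (Cons a v)
    then show ?case
      using f closed[of v] closed[of w] by (cases a) (auto simp: ev_simps m_assoc)
  qed (simp add: ev_simps closed)
  have "\<exists>w \<in> ?W. ev w = g" if "g \<in> generate H (f ` X)" for g
    using that
  proof (induction g rule: generate.induct)
    case one
    show ?case by (intro bexI[of _ "[]"]) (auto simp: ev_simps)
  next
    case (incl g)
    then obtain x where "x \<in> X" "g = f x" by auto
    then show ?case
      using f by (intro bexI[of _ "[(x, True)]"]) (auto simp: ev_simps)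
  next
    case (inv g)
    then obtain x where "x \<in> X" "g = f x" by auto
    then show ?case
      using f by (intro bexI[of _ "[(x, False)]"]) (auto simp: ev_simps)
  next
    case (eng g h)
    then obtain v w where "v \<in> ?W" "ev v = g" "w \<in> ?W" "ev w = h" by auto
    then show ?case
      by (intro bexI[of _ "v @ w"]) (auto simp: app)
  qed
  then have "generate H (f ` X) \<subseteq> range ev" by blast
  then have "inj_on (inv_into UNIV ev) (generate H (f ` X))"
    by (rule inj_on_inv_into)
  then show thesis by (rule that)
qed

lemma free_paratopological_group_extension:
  fixes H :: "('h, 'n) monoid_scheme"
  assumes free: "free_paratopological_group X G T i"
    and "paratopological_group H S" and f: "continuous_map X S f"
  shows "\<exists>h \<in> hom G H. continuous_map T S h \<and> (\<forall>x \<in> topspace X. h (i x) = f x)"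
proof -
  interpret paratopological_group H S by fact
  let ?Y = "generate H (f ` topspace X)"
  have fX: "f ` topspace X \<subseteq> carrier H"
    using f topspace_eq by (auto simp: continuous_map_def)
  obtain e :: "'h \<Rightarrow> ('a \<times> bool) list" where e: "inj_on e ?Y"
    using generate_embeds_in_words[OF is_group fX] by blast
  let ?p = "the_inv_into ?Y e"
  let ?A = "e ` ?Y"
  let ?S = "subtopology S ?Y"
  have YH: "?Y \<subseteq> carrier H"
    using fX by (rule generate_incl)
  have p: "bij_betw ?p ?A (carrier (H\<lparr>carrier := ?Y\<rparr>))"
    using e by (simp add: bij_betw_the_inv_into inj_on_imp_bij_betw)
  have pe: "?p (e y) = y" if "y \<in> ?Y" for y
    using e that by (simp add: the_inv_into_f_f)
  have "paratopological_group (H\<lparr>carrier := ?Y\<rparr>) ?S"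
    using paratopological_group_subgroup[OF assms(2) generate_is_subgroup[OF fX]] .
  then obtain K :: "('a \<times> bool) list monoid" where
    K: "paratopological_group K (pullback_topology ?A ?p ?S)" "?p \<in> iso K (H\<lparr>carrier := ?Y\<rparr>)"
    using paratopological_group_transport[OF _ p] by metis
  have fY: "f x \<in> ?Y" if "x \<in> topspace X" for x
    using that by (auto intro: generate.incl)
  have "continuous_map X (pullback_topology ?A ?p ?S) (e \<circ> f)"
  proof (rule continuous_map_pullback')
    have "continuous_map X ?S f"
      using f fY by (auto simp: continuous_map_in_subtopology)
    then show "continuous_map X ?S (?p \<circ> (e \<circ> f))"
      by (rule continuous_map_eq) (simp add: pe fY)
  qed (use fY in auto)
  then obtain k where k: "k \<in> hom G K" "continuous_map T (pullback_topology ?A ?p ?S) k"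
      "\<forall>x \<in> topspace X. k (i x) = (e \<circ> f) x"
    using free K(1) unfolding free_paratopological_group_def by meson
  show ?thesis
  proof (intro bexI[of _ "?p \<circ> k"] conjI ballI)
    have "?p \<circ> k \<in> hom G (H\<lparr>carrier := ?Y\<rparr>)"
      using k(1) K(2) by (auto simp: iso_def hom_def Pi_iff)
    then show "?p \<circ> k \<in> hom G H"
      using YH by (auto simp: hom_def)
    have "continuous_map (pullback_topology ?A ?p ?S) ?S ?p"
      using continuous_map_pullback[OF continuous_map_id, of ?A ?p ?S] by simp
    then have "continuous_map T ?S (?p \<circ> k)"
      using k(2) continuous_map_compose by blast
    then show "continuous_map T S (?p \<circ> k)"
      by (simp add: continuous_map_in_subtopology)
    show "(?p \<circ> k) (i x) = f x" if "x \<in> topspace X" for x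
      using that k(3) by (simp add: pe fY)
  qed
qed

text \<open>
  The predicate is satisfiable for every \<open>X\<close> (no separation axiom): take the subgroup generated by
  the image of \<open>X\<close> in the product of all test groups. Maps into the integers with the up-set
  topology recover the open sets of \<open>X\<close>, maps into the indiscrete integers its points.
\<close>

lemma paratopological_group_product:
  assumes "\<And>j. j \<in> J \<Longrightarrow> paratopological_group (H j) (S j)"
  shows "paratopological_group (product_group J H) (product_topology S J)"
proof (intro paratopological_group.intro paratopological_group_axioms.intro)
  let ?P = "product_topology S J"
  show "group (product_group J H)"
    using assms by (simp add: paratopological_group_def)
  show top: "topspace ?P = carrier (product_group J H)"
    by (auto simp: paratopological_group.topspace_eq[OF assms] cong: PiE_cong)
  have "continuous_map (prod_topology ?P ?P) (S j) (\<lambda>z. fst z j \<otimes>\<^bsub>H j\<^esub> snd z j)" if j: "j \<in> J" for j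
  proof -
    have c: "continuous_map ?P (S j) (\<lambda>x. x j)"
      using j by (rule continuous_map_product_projection)
    have "continuous_map (prod_topology ?P ?P) (prod_topology (S j) (S j)) (\<lambda>z. (fst z j, snd z j))"
      using continuous_map_compose[OF continuous_map_fst c] continuous_map_compose[OF continuous_map_snd c]
      by (intro continuous_map_pairedI) (simp_all add: o_def)
    from continuous_map_compose[OF this paratopological_group.continuous_mult[OF assms[OF j]]]
    show ?thesis by (simp add: o_def)
  qed
  then show "continuous_map (prod_topology ?P ?P) ?P (\<lambda>(x, y). x \<otimes>\<^bsub>product_group J H\<^esub> y)"
    by (auto simp: continuous_map_componentwise case_prod_unfold)
qed

definition int_add_group :: "int monoid" where
  "int_add_group = \<lparr>carrier = UNIV, monoid.mult = (+), one = 0\<rparr>"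

definition int_upset_topology :: "int topology" where
  "int_upset_topology = topology (\<lambda>U. \<forall>x \<in> U. \<forall>y \<ge> x. y \<in> U)"

lemma openin_int_upset: "openin int_upset_topology U \<longleftrightarrow> (\<forall>x \<in> U. \<forall>y \<ge> x. y \<in> U)"
proof -
  have "istopology (\<lambda>U :: int set. \<forall>x \<in> U. \<forall>y \<ge> x. y \<in> U)"
    unfolding istopology_def by blast
  then show ?thesis by (simp add: int_upset_topology_def)
qed

lemma topspace_int_upset: "topspace int_upset_topology = UNIV"
  using openin_subset[of int_upset_topology UNIV] by (auto simp: openin_int_upset)

lemma group_int_add: "group int_add_group"
proof (rule groupI)
  fix x assume "x \<in> carrier int_add_group"
  show "\<exists>y\<in>carrier int_add_group. y \<otimes>\<^bsub>int_add_group\<^esub> x = \<one>\<^bsub>int_add_group\<^esub>"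
    by (intro bexI[of _ "- x"]) (auto simp: int_add_group_def)
qed (auto simp: int_add_group_def)

lemma paratopological_group_int_upset: "paratopological_group int_add_group int_upset_topology"
proof (intro paratopological_group.intro paratopological_group_axioms.intro)
  let ?Z = int_upset_topology
  show "topspace ?Z = carrier int_add_group"
    by (simp add: topspace_int_upset int_add_group_def)
  have "openin (prod_topology ?Z ?Z) {z. fst z + snd z \<in> U}" if U: "openin ?Z U" for U
    unfolding openin_prod_topology_alt
  proof (intro allI impI)
    fix x y assume "(x, y) \<in> {z. fst z + snd z \<in> U}"
    then show "\<exists>A B. openin ?Z A \<and> openin ?Z B \<and> x \<in> A \<and> y \<in> B \<and> A \<times> B \<subseteq> {z. fst z + snd z \<in> U}"
      using U by (intro exI[of _ "{x..}"] exI[of _ "{y..}"]) (force simp: openin_int_upset)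
  qed
  then show "continuous_map (prod_topology ?Z ?Z) ?Z (\<lambda>(x, y). x \<otimes>\<^bsub>int_add_group\<^esub> y)"
    by (auto simp: continuous_map_def topspace_int_upset int_add_group_def case_prod_unfold)
qed (rule group_int_add)

lemma paratopological_group_indiscrete:
  assumes "group H"
  shows "paratopological_group H (pullback_topology (carrier H) (\<lambda>_. ()) (discrete_topology UNIV))"
proof (intro paratopological_group.intro paratopological_group_axioms.intro)
  let ?I = "pullback_topology (carrier H) (\<lambda>_. ()) (discrete_topology UNIV)"
  interpret group H by fact
  show "topspace ?I = carrier H"
    by (simp add: topspace_pullback_topology)
  show "continuous_map (prod_topology ?I ?I) ?I (\<lambda>(x, y). x \<otimes>\<^bsub>H\<^esub> y)"
    by (rule continuous_map_pullback') (auto simp: topspace_pullback_topology o_def)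
qed (use assms in auto)

lemma free_paratopological_group_exists:
  fixes X :: "'a topology"
  shows "\<exists>(G :: (('a \<times> bool) list monoid \<times> ('a \<times> bool) list topology \<times> ('a \<Rightarrow> ('a \<times> bool) list)
            \<Rightarrow> ('a \<times> bool) list) monoid) T i. free_paratopological_group X G T i"
proof -
  define J :: "(('a \<times> bool) list monoid \<times> ('a \<times> bool) list topology \<times> ('a \<Rightarrow> ('a \<times> bool) list)) set"
    where "J = {(H, S, f). paratopological_group H S \<and> continuous_map X S f}"
  define P where "P = product_group J fst"
  define S where "S = product_topology (\<lambda>j. fst (snd j)) J"
  define i where "i = (\<lambda>x. \<lambda>j\<in>J. snd (snd j) x)"
  define Y where "Y = generate P (i ` topspace X)"
  define G where "G = P\<lparr>carrier := Y\<rparr>"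
  define T where "T = subtopology S Y"
  have P: "paratopological_group P S"
    unfolding P_def S_def by (rule paratopological_group_product) (auto simp: J_def)
  then interpret P: paratopological_group P S .
  have i: "continuous_map X S i"
    unfolding S_def continuous_map_componentwise by (auto simp: i_def J_def)
  then have iP: "i ` topspace X \<subseteq> carrier P"
    using P.topspace_eq by (auto simp: continuous_map_def)
  have Y: "subgroup Y P"
    unfolding Y_def using iP by (rule P.generate_is_subgroup)
  have iY: "i ` topspace X \<subseteq> Y"
    unfolding Y_def by (auto intro: generate.incl)
  have YP: "Y \<subseteq> carrier P"
    using Y by (rule subgroup.subset)
  have G: "paratopological_group G T"
    unfolding G_def T_def using P Y by (rule paratopological_group_subgroup)

  define e :: "int \<Rightarrow> ('a \<times> bool) list" where "e k = replicate (to_nat k) undefined" for k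
  define q where "q = inv_into UNIV e"
  have "inj e"
    by (rule injI) (auto simp: e_def)
  then have p: "bij_betw (q) (range e) (carrier int_add_group)" and pe: "q (e k) = k" for k
    by (simp_all add: q_def int_add_group_def inj_imp_bij_betw_inv)
  have test: "\<exists>j \<in> J. snd (snd j) = e \<circ> f \<and> fst (snd j) = pullback_topology (range e) (q) Z"
    if Z: "paratopological_group int_add_group Z" and f: "continuous_map X Z f" for Z f
  proof -
    obtain K :: "('a \<times> bool) list monoid" where
      "paratopological_group K (pullback_topology (range e) (q) Z)"
      by (rule paratopological_group_transport[OF Z p])
    moreover have "continuous_map X (pullback_topology (range e) (q) Z) (e \<circ> f)"
      by (rule continuous_map_pullback') (use f in \<open>auto simp: o_def pe\<close>)
    ultimately show ?thesis
      by (intro bexI[of _ "(K, pullback_topology (range e) (q) Z, e \<circ> f)"]) (auto simp: J_def)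
  qed

  have "inj_on i (topspace X)"
  proof (rule inj_onI, rule ccontr)
    fix x y assume xy: "i x = i y" "x \<noteq> y"
    define f where "f = (\<lambda>z. if z = x then 1 else 0 :: int)"
    let ?I = "pullback_topology (carrier int_add_group) (\<lambda>_. ()) (discrete_topology UNIV)"
    have "continuous_map X ?I f"
      by (rule continuous_map_pullback') (auto simp: int_add_group_def o_def)
    then obtain j where "j \<in> J" "snd (snd j) = e \<circ> f"
      using test[OF paratopological_group_indiscrete[OF group_int_add]] by blast
    then have "(e \<circ> f) x = (e \<circ> f) y"
      using fun_cong[OF xy(1), of j] by (simp add: i_def)
    then have "f x = f y"
      using \<open>inj e\<close> by (simp add: inj_eq)
    then show False
      using xy(2) by (simp add: f_def)
  qed
  moreover have "open_map X (subtopology S (i ` topspace X)) i"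
    unfolding open_map_def
  proof (intro allI impI)
    fix U assume U: "openin X U"
    define f where "f = (\<lambda>z. if z \<in> U then 1 else 0 :: int)"
    have "openin X {x \<in> topspace X. f x \<in> V}" if "openin int_upset_topology V" for V
    proof -
      have "0 \<in> V \<longrightarrow> 1 \<in> V"
        using that by (auto simp: openin_int_upset)
      moreover have "U \<inter> topspace X = U" "topspace X \<inter> U = U"
        using openin_subset[OF U] by auto
      ultimately have "{x \<in> topspace X. f x \<in> V}
          = (if 0 \<in> V then topspace X else if 1 \<in> V then U else {})"
        by (auto simp: f_def)
      then show ?thesis
        using U by simp
    qed
    then have "continuous_map X int_upset_topology f"
      by (simp add: continuous_map_def topspace_int_upset)
    then obtain j where j: "j \<in> J" "snd (snd j) = e \<circ> f"
        "fst (snd j) = pullback_topology (range e) (q) int_upset_topology"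
      using test[OF paratopological_group_int_upset] by blast
    define V where "V = q -` {1..} \<inter> range e"
    have "openin (fst (snd j)) V"
      unfolding j openin_pullback_topology V_def by (auto simp: openin_int_upset intro!: exI[of _ "{1..}"])
    then have "openin S {g \<in> topspace S. g j \<in> V}"
      using continuous_map_product_projection[OF j(1), of "\<lambda>j. fst (snd j)"]
      unfolding S_def continuous_map_def by blast
    moreover have "i x j \<in> V \<longleftrightarrow> x \<in> U" for x
      using j by (simp add: i_def V_def pe f_def)
    then have "i ` U = {g \<in> topspace S. g j \<in> V} \<inter> i ` topspace X"
      using iP openin_subset[OF U] unfolding P.topspace_eq by blast
    ultimately show "openin (subtopology S (i ` topspace X)) (i ` U)"
      unfolding openin_subtopology by blast
  qed
  ultimately have "embedding_map X (subtopology S (i ` topspace X)) i"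
    using i by (intro injective_open_imp_embedding_map)
      (simp_all add: continuous_map_in_subtopology image_subset_iff_funcset[symmetric] del: image_subset_iff_funcset)
  then have "embedding_map X T i"
    using iY by (simp add: T_def embedding_map_in_subtopology)
  moreover have "generate G (i ` topspace X) = carrier G"
    using P.generate_consistent[OF iY Y] by (simp add: G_def Y_def)
  moreover have "\<exists>h \<in> hom G H. continuous_map T R h \<and> (\<forall>x \<in> topspace X. h (i x) = f x)"
    if "paratopological_group H R" "continuous_map X R f" for H :: "('a \<times> bool) list monoid" and R f
  proof -
    have j: "(H, R, f) \<in> J"
      using that by (simp add: J_def)
    show ?thesis
    proof (intro bexI[of _ "\<lambda>g. g (H, R, f)"] conjI ballI)
      show "continuous_map T R (\<lambda>g. g (H, R, f))"
        using continuous_map_product_projection[OF j, of "\<lambda>j. fst (snd j)"]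
        by (simp add: T_def S_def continuous_map_from_subtopology)
      have "g (H, R, f) \<in> carrier H" if "g \<in> Y" for g
        using PiE_mem[of g J "\<lambda>j. carrier (fst j)", OF _ j] subsetD[OF YP that] by (simp add: P_def)
      then show "(\<lambda>g. g (H, R, f)) \<in> hom G H"
        using j by (simp add: hom_def G_def P_def Pi_iff)
    qed (use j in \<open>simp add: i_def\<close>)
  qed
  ultimately have "free_paratopological_group X G T i"
    using G by (simp add: free_paratopological_group_def)
  then show ?thesis by blast
qed

end

theory Submission
  imports Defs
begin

text \<open>
  The order automorphisms of the real line, ordered pointwise, form a group whose order is invariant
  under both translations, so the upper sets are a paratopological group topology on it. A family of
  automorphisms \<open>r \<mapsto> r + 1\<close>, lowered by \<open>\<epsilon>\<close> at the points of a finite set \<open>D\<^sub>p\<close>, gives a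
  continuous map \<open>p \<mapsto> f\<^sub>p\<close> on \<open>X\<close> as soon as every set \<open>{p. s \<notin> D\<^sub>p}\<close> is open, and hence a
  continuous homomorphism on the free group; open sets of the free group are obtained by
  looking at the image of \<open>0\<close>.

  The map \<open>(x\<^sub>0, \<dots>, x\<^bsub>n-1\<^esub>) \<mapsto> x\<^bsub>n-1\<^esub> \<cdots> x\<^sub>0\<close> is an embedding: given open sets \<open>O\<^sub>j\<close>,
  lower \<open>f\<^sub>p\<close> at those \<open>j\<close> with \<open>p \<notin> O\<^sub>j\<close>. Then \<open>0\<close> is moved to \<open>n\<close> exactly
  if \<open>x\<^sub>j \<in> O\<^sub>j\<close> for all \<open>j\<close>, and to a smaller number otherwise.

  The image is closed: let \<open>g\<close> be a reduced word of exponent sum \<open>n\<close> with a negative letter. Lower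
  \<open>f\<^sub>a\<close> just at the finitely many points where \<open>g\<close>, read from the right, applies \<open>f\<^sub>a\<close> inversely;
  in a \<open>T\<^sub>1\<close> space this is a continuous choice. Then \<open>g\<close> moves \<open>0\<close> beyond \<open>n\<close>, whereas a positive
  word of length \<open>n\<close> moves \<open>0\<close> to at most \<open>n\<close>. Constant translations take care of the words of
  other exponent sums.
\<close>

section \<open>Order automorphisms of a chain\<close>

definition order_aut :: "('c::linorder \<Rightarrow> 'c) monoid" where
  "order_aut = \<lparr>carrier = {f. strict_mono f \<and> surj f}, monoid.mult = (\<circ>), one = id\<rparr>"

text \<open>This is the Alexandrov topology of the pointwise order: each automorphism has a least
  neighbourhood, the set of automorphisms above it.\<close>

definition order_aut_topology :: "('c::linorder \<Rightarrow> 'c) topology" where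
  "order_aut_topology = topology (\<lambda>W. W \<subseteq> carrier order_aut \<and>
     (\<forall>f \<in> W. \<forall>g \<in> carrier order_aut. f \<le> g \<longrightarrow> g \<in> W))"

lemma order_aut_simps [simp]:
  "f \<in> carrier order_aut \<longleftrightarrow> strict_mono f \<and> surj f"
  "f \<otimes>\<^bsub>order_aut\<^esub> g = f \<circ> g" "\<one>\<^bsub>order_aut\<^esub> = id"
  by (simp_all add: order_aut_def)

lemma id_order_aut: "id \<in> carrier order_aut"
  by (simp add: strict_mono_def)

lemma comp_order_aut:
  assumes "f \<in> carrier order_aut" "g \<in> carrier order_aut"
  shows "f \<circ> g \<in> carrier order_aut"
  using assms comp_surj[of g f] strict_mono_o[of f g] by (simp only: order_aut_simps)

lemma group_order_aut: "group (order_aut :: ('c::linorder \<Rightarrow> 'c) monoid)"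
proof (rule groupI)
  fix f :: "'c \<Rightarrow> 'c" assume "f \<in> carrier order_aut"
  then have f: "strict_mono f" "surj f" by auto
  then have bij: "bij f"
    by (simp add: bij_def strict_mono_imp_inj_on)
  have "inv_into UNIV f x < inv_into UNIV f y" if "x < y" for x y
    using f that by (metis strict_mono_less surj_f_inv_f)
  then show "\<exists>g\<in>carrier order_aut. g \<otimes>\<^bsub>order_aut\<^esub> f = \<one>\<^bsub>order_aut\<^esub>"
    using bij by (intro bexI[of _ "inv_into UNIV f"])
      (auto simp: strict_mono_def bij_is_inj bij_imp_bij_inv bij_is_surj)
qed (simp_all add: comp_order_aut id_order_aut o_assoc del: order_aut_simps(1))

lemma order_aut_inv_apply:
  assumes "f \<in> carrier order_aut" "f s = t"
  shows "(inv\<^bsub>order_aut\<^esub> f) t = s"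
proof -
  have "inv\<^bsub>order_aut\<^esub> f \<otimes>\<^bsub>order_aut\<^esub> f = \<one>\<^bsub>order_aut\<^esub>"
    using group.l_inv[OF group_order_aut assms(1)] .
  then show ?thesis
    using assms(2) by (auto simp: fun_eq_iff)
qed

lemma openin_order_aut:
  fixes W :: "('c::linorder \<Rightarrow> 'c) set"
  shows "openin order_aut_topology W \<longleftrightarrow> W \<subseteq> carrier order_aut \<and>
     (\<forall>f \<in> W. \<forall>g \<in> carrier order_aut. f \<le> g \<longrightarrow> g \<in> W)"
proof -
  have "istopology (\<lambda>W :: ('c::linorder \<Rightarrow> 'c) set. W \<subseteq> carrier order_aut \<and>
     (\<forall>f \<in> W. \<forall>g \<in> carrier order_aut. f \<le> g \<longrightarrow> g \<in> W))"
    unfolding istopology_def by blast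
  then show ?thesis by (simp only: order_aut_topology_def topology_inverse')
qed

lemma topspace_order_aut: "topspace order_aut_topology = carrier order_aut"
proof
  have "openin order_aut_topology (topspace order_aut_topology)"
    by (rule openin_topspace)
  then show "topspace order_aut_topology \<subseteq> carrier order_aut"
    unfolding openin_order_aut by blast
  have "openin order_aut_topology (carrier order_aut)"
    unfolding openin_order_aut by blast
  then show "carrier order_aut \<subseteq> topspace order_aut_topology"
    by (rule openin_subset)
qed

text \<open>Composition of increasing maps is monotone in both factors, so the least neighbourhoods
  of \<open>f\<close> and \<open>g\<close> multiply into every upper set containing
  \<open>f \<circ> g\<close>.\<close>

lemma paratopological_group_order_aut:
  "paratopological_group (order_aut :: ('c::linorder \<Rightarrow> 'c) monoid) order_aut_topology"
proof (intro paratopological_group.intro paratopological_group_axioms.intro)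
  let ?T = "order_aut_topology :: ('c \<Rightarrow> 'c) topology"
  have "openin (prod_topology ?T ?T) {z \<in> topspace ?T \<times> topspace ?T. fst z \<circ> snd z \<in> U}"
    if U: "openin ?T U" for U
    unfolding openin_prod_topology_alt
  proof (intro allI impI)
    fix f g assume "(f, g) \<in> {z \<in> topspace ?T \<times> topspace ?T. fst z \<circ> snd z \<in> U}"
    then have fg: "f \<in> carrier order_aut" "g \<in> carrier order_aut" "f \<circ> g \<in> U"
      by (auto simp: topspace_order_aut)
    define up where "up k = {k' \<in> carrier order_aut. k \<le> k'}" for k :: "'c \<Rightarrow> 'c"
    have up: "openin ?T (up k)" for k
      by (auto simp: openin_order_aut up_def)
    have "f' \<circ> g' \<in> U" if "f' \<in> up f" "g' \<in> up g" for f' g'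
    proof -
      have *: "f' \<in> carrier order_aut" "g' \<in> carrier order_aut" "f \<le> f'" "g \<le> g'"
        using that by (auto simp: up_def)
      have "f (g r) \<le> f' (g' r)" for r
      proof -
        have "f (g r) \<le> f' (g r)" using *(3) by (simp add: le_fun_def)
        also have "\<dots> \<le> f' (g' r)"
          using * by (simp add: le_fun_def strict_mono_less_eq)
        finally show ?thesis .
      qed
      then have "f \<circ> g \<le> f' \<circ> g'" by (simp add: le_fun_def)
      then show ?thesis
        using U fg(3) comp_order_aut[OF *(1,2)] unfolding openin_order_aut by blast
    qed
    moreover have "f \<in> up f" "g \<in> up g"
      using fg by (auto simp: up_def)
    moreover have "up f \<subseteq> topspace ?T" "up g \<subseteq> topspace ?T"
      using up openin_subset by blast+
    ultimately show "\<exists>A B. openin ?T A \<and> openin ?T B \<and> f \<in> A \<and> g \<in> B \<and>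
        A \<times> B \<subseteq> {z \<in> topspace ?T \<times> topspace ?T. fst z \<circ> snd z \<in> U}"
      using up by (intro exI[of _ "up f"] exI[of _ "up g"]) auto
  qed
  then show "continuous_map (prod_topology ?T ?T) ?T (\<lambda>(f, g). f \<otimes>\<^bsub>order_aut\<^esub> g)"
    using comp_order_aut
    by (auto simp: continuous_map_def topspace_order_aut case_prod_unfold simp del: order_aut_simps(1))
qed (simp_all add: group_order_aut topspace_order_aut)

lemma min_order_aut:
  assumes "f \<in> carrier order_aut" "g \<in> carrier order_aut"
  shows "(\<lambda>r. min (f r) (g r)) \<in> carrier order_aut"
proof -
  have f: "strict_mono f" "surj f" and g: "strict_mono g" "surj g"
    using assms by auto
  have "\<exists>r. min (f r) (g r) = y" for y
  proof -
    obtain u v where uv: "f u = y" "g v = y"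
      using f(2) g(2) by (metis surjD)
    \<comment> \<open>At the larger of \<open>u\<close> and \<open>v\<close> one function has the
      value \<open>y\<close> and the other is at least \<open>y\<close>.\<close>
    then have "min (f (max u v)) (g (max u v)) = y"
      using strict_mono_less_eq[OF f(1)] strict_mono_less_eq[OF g(1)]
      by (metis max_def min.absorb1 min.absorb2 linear)
    then show ?thesis ..
  qed
  then have "surj (\<lambda>r. min (f r) (g r))"
    by (metis surjI)
  then show ?thesis
    using f(1) g(1) by (auto simp: strict_mono_def min_def) (meson less_trans not_le le_less_trans)+
qed

section \<open>Lowered translations of the real line\<close>

text \<open>
  The branch at \<open>s\<close> has slope \<open>1/2\<close> on the left and \<open>2\<close> on the right, so it meets \<open>r + 1\<close>
  exactly at \<open>s - 2 * e\<close> and \<open>s + e\<close>.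
\<close>

definition dent :: "real \<Rightarrow> real set \<Rightarrow> real \<Rightarrow> real" where
  "dent e D r = Min (insert (r + 1) ((\<lambda>s. s + 1 - e + max (2 * (r - s)) ((r - s) / 2)) ` D))"

lemma dent_order_aut:
  assumes "finite D"
  shows "dent e D \<in> carrier order_aut"
  using assms
proof (induction D rule: finite_induct)
  case empty
  show ?case
    by (auto simp: dent_def strict_mono_def intro!: surjI[of _ "\<lambda>y. y - 1"])
next
  case (insert s D)
  let ?g = "\<lambda>r. s + 1 - e + max (2 * (r - s)) ((r - s) / 2)"
  have "surj ?g"
    \<comment> \<open>The inverse of the maximum of two increasing lines is the minimum of the
      inverse lines.\<close>
    by (rule surjI[of _ "\<lambda>y. s + min ((y - (s + 1 - e)) / 2) (2 * (y - (s + 1 - e)))"])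
      (auto simp: max_def min_def field_simps)
  moreover have "strict_mono ?g"
    by (auto simp: strict_mono_def max_def)
  ultimately have g: "?g \<in> carrier order_aut" by simp
  have "dent e (insert s D) = (\<lambda>r. min (?g r) (dent e D r))"
    using insert.hyps by (simp add: dent_def fun_eq_iff insert_commute[of "_ + 1"])
  then show ?case
    using min_order_aut[OF g insert.IH] by simp
qed

lemma dent_antimono:
  assumes "finite D'" "D \<subseteq> D'"
  shows "dent e D' \<le> dent e D"
  unfolding le_fun_def dent_def
  using assms by (intro allI Min_antimono) (auto intro: finite_subset)

lemma dent_le:
  assumes "finite D"
  shows "dent e D r \<le> r + 1"
  using assms by (simp add: dent_def)

text \<open>Since \<open>max (2 * x) (x / 2) \<ge> x\<close>, no branch is lower at \<open>s\<close>
  than the branch centred there. Dents therefore do not disturb each other at their centres, however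
  close these lie.\<close>

lemma dent_at:
  assumes "finite D" "s \<in> D" "e \<ge> 0"
  shows "dent e D s = s + 1 - e"
  unfolding dent_def
proof (rule Min_eqI)
  let ?g = "\<lambda>t. t + 1 - e + max (2 * (s - t)) ((s - t) / 2)"
  show "s + 1 - e \<le> y" if "y \<in> insert (s + 1) (?g ` D)" for y
    using that assms(3) by (auto simp: max_def field_simps)
  have "s + 1 - e = ?g s" by simp
  then show "s + 1 - e \<in> insert (s + 1) (?g ` D)"
    using assms(2) by blast
qed (use assms in simp)

text \<open>With \<open>x = r - s\<close>, the branch at \<open>s\<close> exceeds
  \<open>r + 1\<close> by \<open>max x (- x / 2) - e\<close>, which is nonnegative once
  \<open>x \<ge> e\<close> or \<open>x \<le> - 2 * e\<close>.\<close>

lemma dent_off: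
  assumes "finite D" "e \<ge> 0" "\<And>s. s \<in> D \<Longrightarrow> r \<le> s - 2 * e \<or> s + e \<le> r"
  shows "dent e D r = r + 1"
  unfolding dent_def
proof (rule Min_eqI)
  have "r + 1 \<le> s + 1 - e + max (2 * (r - s)) ((r - s) / 2)" if "s \<in> D" for s
    using assms(2) assms(3)[OF that] by (auto simp: max_def field_simps)
  then show "r + 1 \<le> y"
    if "y \<in> insert (r + 1) ((\<lambda>s. s + 1 - e + max (2 * (r - s)) ((r - s) / 2)) ` D)" for y
    using that by auto
qed (use assms in simp_all)

text \<open>An upper set containing \<open>dent e (D p)\<close> also contains
  \<open>dent e (D q)\<close> whenever \<open>D q \<subseteq> D p\<close>, and as \<open>E\<close>
  is finite this inclusion holds for all \<open>q\<close> near \<open>p\<close>.\<close>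

lemma continuous_map_dent:
  assumes "finite E" "\<And>p. D p \<subseteq> E" "\<And>s. s \<in> E \<Longrightarrow> openin X {p \<in> topspace X. s \<notin> D p}"
  shows "continuous_map X order_aut_topology (\<lambda>p. dent e (D p))"
proof -
  have fin: "finite (D p)" for p
    using assms(1,2) finite_subset by blast
  have "openin X {p \<in> topspace X. dent e (D p) \<in> W}" if W: "openin order_aut_topology W" for W
  proof (subst openin_subopen, intro ballI)
    fix p assume p: "p \<in> {p \<in> topspace X. dent e (D p) \<in> W}"
    define N where "N = topspace X \<inter> (\<Inter>s \<in> E - D p. {q \<in> topspace X. s \<notin> D q})"
    have "openin X N"
      unfolding N_def using assms(1,3) by (intro openin_Int_Inter openin_topspace) auto
    moreover have "p \<in> N"
      using p by (auto simp: N_def)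
    moreover have "dent e (D q) \<in> W" if "q \<in> N" for q
    proof -
      have "D q \<subseteq> D p"
        using that assms(2)[of q] by (auto simp: N_def)
      then show ?thesis
        using W p dent_antimono[OF fin] dent_order_aut[OF fin] unfolding openin_order_aut by blast
    qed
    ultimately show "\<exists>N. openin X N \<and> p \<in> N \<and> N \<subseteq> {p \<in> topspace X. dent e (D p) \<in> W}"
      by (intro exI[of _ N]) (auto simp: N_def)
  qed
  then show ?thesis
    using dent_order_aut[OF fin] by (simp add: continuous_map_def topspace_order_aut)
qed

section \<open>Words\<close>

definition word_eval :: "('g, 'm) monoid_scheme \<Rightarrow> ('a \<Rightarrow> 'g) \<Rightarrow> ('a \<times> bool) list \<Rightarrow> 'g" where
  "word_eval G f w =
     foldr (\<lambda>(x, b) g. (if b then f x else inv\<^bsub>G\<^esub> f x) \<otimes>\<^bsub>G\<^esub> g) w \<one>\<^bsub>G\<^esub>"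

lemma word_eval_simps [simp]:
  "word_eval G f [] = \<one>\<^bsub>G\<^esub>"
  "word_eval G f ((x, b) # w) = (if b then f x else inv\<^bsub>G\<^esub> f x) \<otimes>\<^bsub>G\<^esub> word_eval G f w"
  by (auto simp: word_eval_def)

definition reduced :: "('a \<times> bool) list \<Rightarrow> bool" where
  "reduced w \<longleftrightarrow> (\<nexists>u v a b. w = u @ (a, b) # (a, \<not> b) # v)"

text \<open>The indices descend so that \<open>z 0\<close> is the rightmost letter and acts first;
  lengthening the word puts \<open>z k\<close> in front.\<close>

abbreviation positive_word :: "nat \<Rightarrow> (nat \<Rightarrow> 'a) \<Rightarrow> ('a \<times> bool) list" where
  "positive_word k z \<equiv> map (\<lambda>j. (z j, True)) (rev [0..<k])"

lemma all_positive_imp_positive_word: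
  assumes "\<forall>l \<in> set w. snd l" "w \<in> lists (A \<times> UNIV)"
  shows "\<exists>z \<in> {..<length w} \<rightarrow>\<^sub>E A. w = positive_word (length w) z"
  using assms
proof (induction w)
  case Nil
  then show ?case by simp
next
  case (Cons l w)
  then obtain z where z: "z \<in> {..<length w} \<rightarrow>\<^sub>E A" "w = positive_word (length w) z"
    by auto
  obtain x where l: "l = (x, True)" "x \<in> A"
    using Cons.prems by (cases l) auto
  show ?case
  proof (intro bexI[of _ "z(length w := x)"])
    show "z(length w := x) \<in> {..<length (l # w)} \<rightarrow>\<^sub>E A"
      using PiE_fun_upd[OF l(2) z(1), of "length w"] by (simp add: lessThan_Suc)
    have "positive_word (length w) (z(length w := x)) = positive_word (length w) z"
      by simp
    also have "\<dots> = w" by (rule z(2)[symmetric])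
    finally show "l # w = positive_word (length (l # w)) (z(length w := x))"
      by (simp add: l(1))
  qed
qed

context group
begin

lemma word_eval_closed:
  assumes "f ` A \<subseteq> carrier G" "w \<in> lists (A \<times> UNIV)"
  shows "word_eval G f w \<in> carrier G"
  using assms(2)
proof (induction w)
  case (Cons l w)
  then show ?case using assms(1) by (cases l) auto
qed simp

lemma word_eval_append:
  assumes "f ` A \<subseteq> carrier G" "v \<in> lists (A \<times> UNIV)" "w \<in> lists (A \<times> UNIV)"
  shows "word_eval G f (v @ w) = word_eval G f v \<otimes> word_eval G f w"
  using assms(2)
proof (induction v)
  case Nil
  then show ?case using word_eval_closed[OF assms(1,3)] by simp
next
  case (Cons l v)
  then show ?case
    using assms(1) word_eval_closed[OF assms(1,3)] word_eval_closed[OF assms(1), of v]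
    by (cases l) (auto simp: m_assoc)
qed

lemma generate_imp_word:
  assumes "f ` A \<subseteq> carrier G" "g \<in> generate G (f ` A)"
  shows "\<exists>w \<in> lists (A \<times> UNIV). word_eval G f w = g"
  using assms(2)
proof (induction g rule: generate.induct)
  case one
  show ?case by (intro bexI[of _ "[]"]) auto
next
  case (incl g)
  then obtain x where "x \<in> A" "g = f x" by auto
  then show ?case
    using assms(1) by (intro bexI[of _ "[(x, True)]"]) auto
next
  case (inv g)
  then obtain x where "x \<in> A" "g = f x" by auto
  then show ?case
    using assms(1) by (intro bexI[of _ "[(x, False)]"]) auto
next
  case (eng g h)
  then obtain v w where "v \<in> lists (A \<times> UNIV)" "word_eval G f v = g"
    "w \<in> lists (A \<times> UNIV)" "word_eval G f w = h" by auto
  then show ?case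
    using word_eval_append[OF assms(1)] by (intro bexI[of _ "v @ w"]) auto
qed

text \<open>A shortest word for \<open>g\<close> is reduced, since cancelling an adjacent pair of
  inverse letters would shorten it.\<close>

lemma generate_imp_reduced_word:
  assumes f: "f ` A \<subseteq> carrier G" and g: "g \<in> generate G (f ` A)"
  obtains w where "w \<in> lists (A \<times> UNIV)" "word_eval G f w = g" "reduced w"
proof -
  define P where "P w \<longleftrightarrow> w \<in> lists (A \<times> UNIV) \<and> word_eval G f w = g" for w
  define w where "w = arg_min length P"
  have "\<exists>w. P w"
    using generate_imp_word[OF f g] by (auto simp: P_def)
  then have w: "P w" and min: "\<And>v. P v \<Longrightarrow> length w \<le> length v"
    unfolding w_def by (metis arg_min_natI, metis arg_min_nat_le)
  have "reduced w"
    unfolding reduced_def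
  proof (intro notI, elim exE)
    fix u v a b assume eq: "w = u @ (a, b) # (a, \<not> b) # v"
    have wl: "u \<in> lists (A \<times> UNIV)" "v \<in> lists (A \<times> UNIV)" "a \<in> A"
      using w eq by (auto simp: P_def)
    then have "f a \<in> carrier G" "word_eval G f v \<in> carrier G"
      using f word_eval_closed[OF f] by auto
    then have "word_eval G f ((a, b) # (a, \<not> b) # v) = word_eval G f v"
      by (simp add: m_assoc[symmetric])
    then have "word_eval G f (u @ v) = word_eval G f w"
      using wl by (simp only: eq word_eval_append[OF f]) (simp add: word_eval_append[OF f])
    then have "P (u @ v)"
      using w wl by (simp add: P_def)
    then show False
      using min[of "u @ v"] eq by simp
  qed
  then show thesis
    using that w unfolding P_def by blast
qed

end

lemma hom_word_eval:
  assumes "group G" "group H" "h \<in> hom G H" "f ` A \<subseteq> carrier G"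
    and hf: "\<And>x. x \<in> A \<Longrightarrow> h (f x) = f' x" and "w \<in> lists (A \<times> UNIV)"
  shows "h (word_eval G f w) = word_eval H f' w"
proof -
  interpret group_hom G H h
    using assms by (simp add: group_hom_def group_hom_axioms_def)
  show ?thesis
    using assms(6)
  proof (induction w)
    case (Cons l w)
    then show ?case
      using assms(4) G.word_eval_closed[OF assms(4), of w] by (cases l) (auto simp: hf)
  qed simp
qed

section \<open>The orbit of a reduced word\<close>

definition npos :: "('a \<times> bool) list \<Rightarrow> nat" where
  "npos w = length (filter snd w)"

definition nneg :: "('a \<times> bool) list \<Rightarrow> nat" where
  "nneg w = length (filter (\<lambda>l. \<not> snd l) w)"

text \<open>The intended position of \<open>0\<close> after the word has acted: a positive letter
  adds \<open>1\<close>, while an inverse letter goes back through a dent of depth \<open>e\<close>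
  and subtracts only \<open>1 - e\<close>. For \<open>e = 0\<close> this is the exponent
  sum.\<close>

definition level :: "real \<Rightarrow> ('a \<times> bool) list \<Rightarrow> real" where
  "level e w = real (npos w) - real (nneg w) + e * real (nneg w)"

lemma level_simps [simp]:
  "level e [] = 0"
  "level e ((a, True) # w) = level e w + 1"
  "level e ((a, False) # w) = level e w - 1 + e"
  by (simp_all add: level_def npos_def nneg_def algebra_simps)

lemma level_append: "level e (v @ w) = level e v + level e w"
  by (simp add: level_def npos_def nneg_def algebra_simps)

text \<open>The centres of the dents for \<open>a\<close>, namely the positions where its inverse
  letters are to land: a dent at \<open>s\<close> makes the inverse take \<open>s + 1 - e\<close> to
  \<open>s\<close>.\<close>

definition descents :: "real \<Rightarrow> ('a \<times> bool) list \<Rightarrow> 'a \<Rightarrow> real set" where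
  "descents e w a = {level e ((a, False) # v) | u v. w = u @ (a, False) # v}"

lemma finite_descents: "finite (descents e w a)"
proof (rule finite_subset)
  show "descents e w a \<subseteq> (\<lambda>k. level e (drop k w)) ` {..length w}"
  proof
    fix s assume "s \<in> descents e w a"
    then obtain u v where "w = u @ (a, False) # v" "s = level e ((a, False) # v)"
      by (auto simp: descents_def)
    then have "s = level e (drop (length u) w)" "length u \<le> length w" by simp_all
    then show "s \<in> (\<lambda>k. level e (drop k w)) ` {..length w}" by blast
  qed
qed simp

text \<open>A nonzero integer \<open>npos z - nneg z\<close> decides the alternative, because the
  correction \<open>e * nneg z\<close> is at most \<open>1 - 2 * e\<close>. If it is zero,
  \<open>z\<close> contains an inverse letter and the correction is at least
  \<open>e\<close>.\<close>

lemma level_separated: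
  assumes "z \<noteq> []" "e > 0" "e * real (length z + 2) \<le> 1"
  shows "level e z \<le> - 2 * e \<or> e \<le> level e z"
proof -
  have len: "npos z + nneg z = length z"
    by (simp add: npos_def nneg_def sum_length_filter_compl)
  have neg: "e * real (nneg z) + 2 * e \<le> 1"
  proof -
    have "e * real (nneg z) \<le> e * real (length z)"
      using assms(2) len by (intro mult_left_mono) auto
    then show ?thesis using assms(3) by (simp add: algebra_simps)
  qed
  have nonneg: "e * real (nneg z) \<ge> 0"
    using assms(2) by simp
  consider "npos z < nneg z" | "npos z > nneg z" | "npos z = nneg z" by linarith
  then show ?thesis
  proof cases
    case 1
    then have "real (npos z) - real (nneg z) \<le> - 1" by linarith
    then show ?thesis using neg by (simp add: level_def)
  next
    case 2
    then have "real (npos z) - real (nneg z) \<ge> 1" by linarith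
    then show ?thesis using neg nonneg assms(2) unfolding level_def by linarith
  next
    case 3
    then have "real (nneg z) \<ge> 1" using len assms(1) by (cases "nneg z") auto
    then have "e * real (nneg z) \<ge> e" using assms(2) by simp
    then show ?thesis using 3 by (simp add: level_def)
  qed
qed

text \<open>The word \<open>z\<close> between the two letters is nonempty because \<open>w\<close>
  is reduced, so \<open>level_separated\<close> applies to it. The offset
  \<open>level e v - s\<close> is \<open>level e z\<close> or \<open>- level e z - e\<close>,
  depending on the order of the letters. The reflection \<open>x \<mapsto> - x - e\<close> preserves
  the interval from \<open>- 2 * e\<close> to \<open>e\<close>, which is why the branches of
  \<open>dent\<close> have the slopes \<open>1/2\<close> and \<open>2\<close>.\<close>

lemma descents_separated:
  assumes red: "reduced w" and e: "e > 0" "e * real (length w + 2) \<le> 1"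
    and w: "w = u @ (a, True) # v" and s: "s \<in> descents e w a"
  shows "level e v \<le> s - 2 * e \<or> s + e \<le> level e v"
proof -
  have sep: "level e z \<le> - 2 * e \<or> e \<le> level e z" if "z \<noteq> []" "length z \<le> length w" for z :: "('a \<times> bool) list"
  proof -
    have "e * real (length z + 2) \<le> e * real (length w + 2)"
      using that e(1) by (intro mult_left_mono) auto
    then show ?thesis using level_separated[OF that(1) e(1)] e(2) by linarith
  qed
  obtain u' v' where w': "w = u' @ (a, False) # v'" and s: "s = level e v' - 1 + e"
    using s by (auto simp: descents_def)
  have "u @ (a, True) # v = u' @ (a, False) # v'"
    using w w' by simp
  then show ?thesis
    unfolding append_eq_append_conv2
  proof (elim exE disjE conjE)
    \<comment> \<open>The inverse letter stands to the right: the offset is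
      \<open>level e z\<close>.\<close>
    fix y assume "u @ y = u'" "(a, True) # v = y @ (a, False) # v'"
    then obtain z where z: "y = (a, True) # z" "v = z @ (a, False) # v'"
      by (cases y) auto
    have "z \<noteq> []"
    proof
      assume "z = []"
      then have "w = u @ (a, True) # (a, \<not> True) # v'" using w z by simp
      then show False using red unfolding reduced_def by blast
    qed
    then show ?thesis
      using sep[OF \<open>z \<noteq> []\<close>] w s z by (simp add: level_append) linarith
  next
    \<comment> \<open>The inverse letter stands to the left: the offset is
      \<open>- level e z - e\<close>.\<close>
    fix y assume "u = u' @ y" "y @ (a, True) # v = (a, False) # v'"
    then obtain z where z: "y = (a, False) # z" "v' = z @ (a, True) # v"
      by (cases y) auto
    have "z \<noteq> []"
    proof
      assume "z = []"
      then have "w = u' @ (a, False) # (a, \<not> False) # v" using w' z by simp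
      then show False using red unfolding reduced_def by blast
    qed
    then show ?thesis
      using sep[OF \<open>z \<noteq> []\<close>] w' s z by (simp add: level_append) linarith
  qed
qed

text \<open>Letters act from the right, so the induction runs over suffixes \<open>v\<close>, with
  the dents of the whole word \<open>w\<close> kept fixed. A positive letter avoids all dents by
  \<open>descents_separated\<close>; an inverse letter uses the dent placed for it.\<close>

lemma orbit_reduced_word:
  assumes red: "reduced w" and e: "e > 0" "e * real (length w + 2) \<le> 1" and "w = u @ v"
  shows "word_eval order_aut (\<lambda>a. dent e (descents e w a)) v 0 = level e v"
  using assms(4)
proof (induction v arbitrary: u)
  case (Cons l v)
  obtain a b where l: "l = (a, b)" by (cases l)
  let ?f = "dent e (descents e w a)"
  have IH: "word_eval order_aut (\<lambda>a. dent e (descents e w a)) v 0 = level e v"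
    using Cons.IH[of "u @ [l]"] Cons.prems by simp
  show ?case
  proof (cases b)
    case True
    then have "w = u @ (a, True) # v" using Cons.prems l by simp
    from descents_separated[OF red e this] have "?f (level e v) = level e v + 1"
      by (rule dent_off[OF finite_descents less_imp_le[OF e(1)]])
    then show ?thesis using IH l True by simp
  next
    case False
    have "level e ((a, False) # v) \<in> descents e w a"
      using Cons.prems l False unfolding descents_def by blast
    then have "?f (level e v - 1 + e) = level e v"
      using dent_at[OF finite_descents, of "level e v - 1 + e" e w a] e(1) by simp
    then have "(inv\<^bsub>order_aut\<^esub> ?f) (level e v) = level e v - 1 + e"
      by (rule order_aut_inv_apply[OF dent_order_aut[OF finite_descents]])
    then show ?thesis using IH l False by simp
  qed
qed simp

section \<open>Orbits of 0 under translations and under positive words\<close>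

lemma orbit_translation:
  "word_eval order_aut (\<lambda>_ r. r + c) w 0 = c * level 0 w"
proof (induction w)
  case (Cons l w)
  have "(\<lambda>r. r + c) \<in> carrier order_aut"
    by (auto simp: strict_mono_def intro!: surjI[of _ "\<lambda>y. y - c"])
  then have "(inv\<^bsub>order_aut\<^esub> (\<lambda>r. r + c)) y = y - c" for y
    by (rule order_aut_inv_apply) simp
  then show ?case
    using Cons.IH by (cases l; cases "snd l") (auto simp: algebra_simps)
qed simp

lemma level_positive_word: "level e (positive_word k z) = k"
  by (induction k) auto

lemma orbit_positive_word_le:
  assumes "\<And>p r. f p r \<le> r + 1"
  shows "word_eval order_aut f (positive_word k z) 0 \<le> real k"
proof (induction k)
  case (Suc k)
  then show ?case
    using assms[of "z k" "word_eval order_aut f (positive_word k z) 0"] by simp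
qed simp

text \<open>Each letter gains at most \<open>1\<close>, so a single loss is never made up. A dent of
  depth \<open>1/2\<close> at \<open>j\<close> reaches from \<open>j - 1\<close> to
  \<open>j + 1/2\<close> and so affects no integer other than \<open>j\<close>.\<close>

lemma orbit_positive_word_eq_iff:
  fixes D :: "'a \<Rightarrow> nat set"
  assumes "\<And>p. finite (D p)"
  shows "word_eval order_aut (\<lambda>p. dent (1/2) (real ` D p)) (positive_word k z) 0 = real k \<longleftrightarrow>
    (\<forall>j<k. j \<notin> D (z j))"
proof (induction k)
  case (Suc k)
  let ?t = "word_eval order_aut (\<lambda>p. dent (1/2) (real ` D p)) (positive_word k z) 0"
  have fin: "finite (real ` D p)" for p using assms by simp
  have t_le: "?t \<le> real k"
    using dent_le[OF fin] by (intro orbit_positive_word_le)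
  have step: "dent (1/2) (real ` D (z k)) ?t \<le> ?t + 1"
    using dent_le[OF fin] .
  have low: "dent (1/2) (real ` D (z k)) (real k) = real k + 1/2" if "k \<in> D (z k)"
    using dent_at[OF fin, of "real k" "z k" "1/2"] that by simp
  have high: "dent (1/2) (real ` D (z k)) (real k) = real k + 1" if "k \<notin> D (z k)"
  proof (rule dent_off[OF fin])
    show "(0::real) \<le> 1/2" by simp
    fix s assume "s \<in> real ` D (z k)"
    then obtain j where j: "s = real j" "j \<in> D (z k)" by auto
    with that have "j \<noteq> k" by auto
    with j(1) show "real k \<le> s - 2 * (1/2) \<or> s + 1/2 \<le> real k"
      by (cases "j < k") auto
  qed
  have "dent (1/2) (real ` D (z k)) ?t = real k + 1 \<longleftrightarrow> ?t = real k \<and> k \<notin> D (z k)"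
  proof (cases "?t = real k")
    case True
    then show ?thesis
      using low high by (cases "k \<in> D (z k)") simp_all
  next
    case False
    then show ?thesis
      using t_le step by linarith
  qed
  then show ?case
    using Suc.IH by (auto simp: less_Suc_eq add.commute)
qed simp

section \<open>Powers of the space inside the free group\<close>

lemma free_group_continuous:
  assumes "free_paratopological_group X G T i"
  shows "continuous_map X T i"
  using assms unfolding free_paratopological_group_def embedding_map_def
  by (metis continuous_map_in_subtopology homeomorphic_imp_continuous_map)

text \<open>\<open>W\<close> is the preimage, under the homomorphism extending \<open>f\<close>, of
  the upper set of automorphisms that take \<open>0\<close> to at least \<open>c\<close>.\<close>

lemma orbit_open_set:
  assumes free: "free_paratopological_group X G T i"
    and f: "continuous_map X order_aut_topology f"
  shows "\<exists>W. openin T W \<and> (\<forall>w \<in> lists (topspace X \<times> UNIV).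
    word_eval G i w \<in> W \<longleftrightarrow> c \<le> word_eval order_aut f w (0::real))"
proof -
  interpret paratopological_group G T
    using free by (simp add: free_paratopological_group_def)
  have iG: "i ` topspace X \<subseteq> carrier G"
    using continuous_map_image_subset_topspace[OF free_group_continuous[OF free]] topspace_eq by simp
  obtain h where h: "h \<in> hom G order_aut" "continuous_map T order_aut_topology h"
    "\<forall>x \<in> topspace X. h (i x) = f x"
    using free_paratopological_group_extension[OF free paratopological_group_order_aut f] by blast
  let ?U = "{k \<in> carrier order_aut. c \<le> k (0::real)}"
  have "openin order_aut_topology ?U"
    by (auto simp: openin_order_aut le_fun_def intro: order_trans)
  then have op: "openin T {g \<in> topspace T. h g \<in> ?U}"
    using h(2) by (auto simp: continuous_map_def)
  have "word_eval G i w \<in> {g \<in> topspace T. h g \<in> ?U} \<longleftrightarrow> c \<le> word_eval order_aut f w 0"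
    if w: "w \<in> lists (topspace X \<times> UNIV)" for w
  proof -
    have "h (word_eval G i w) = word_eval order_aut f w"
      using hom_word_eval[OF is_group group_order_aut h(1) iG _ w] h(3) by blast
    moreover have "word_eval G i w \<in> carrier G"
      using word_eval_closed[OF iG w] .
    moreover have "h (word_eval G i w) \<in> carrier order_aut"
      using hom_in_carrier[OF h(1)] calculation(2) .
    ultimately show ?thesis by (simp add: topspace_eq)
  qed
  with op show ?thesis by blast
qed

lemma positive_word_in_lists:
  assumes "z \<in> {..<n} \<rightarrow>\<^sub>E A"
  shows "positive_word n z \<in> lists (A \<times> UNIV)"
proof -
  have "z j \<in> A" if "j < n" for j
    by (rule PiE_mem[OF assms]) (simp add: that)
  then show ?thesis by auto
qed

text \<open>Open boxes of the power are traces of open sets of the free group; both injectivity and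
  openness of the embedding rest on this.\<close>

lemma box_open_set:
  assumes free: "free_paratopological_group X G T i"
    and B: "\<And>j. j < n \<Longrightarrow> openin X (B j)"
  shows "\<exists>W. openin T W \<and> (\<forall>z \<in> {..<n} \<rightarrow>\<^sub>E topspace X.
    word_eval G i (positive_word n z) \<in> W \<longleftrightarrow> (\<forall>j<n. z j \<in> B j))"
proof -
  define D where "D p = {j. j < n \<and> p \<notin> B j}" for p
  have fin: "finite (D p)" for p by (simp add: D_def)
  have "continuous_map X order_aut_topology (\<lambda>p. dent (1/2) (real ` D p))"
  proof (rule continuous_map_dent)
    fix s assume "s \<in> real ` {..<n}"
    then obtain j where j: "s = real j" "j < n" by auto
    then have "{p \<in> topspace X. s \<notin> real ` D p} = B j"
      using openin_subset[OF B[OF j(2)]] by (auto simp: D_def)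
    then show "openin X {p \<in> topspace X. s \<notin> real ` D p}"
      using B[OF j(2)] by simp
  qed (auto simp: D_def)
  from orbit_open_set[OF free this, of "real n"]
  obtain W where W: "openin T W" and iff: "\<forall>w \<in> lists (topspace X \<times> UNIV).
      word_eval G i w \<in> W \<longleftrightarrow>
      real n \<le> word_eval order_aut (\<lambda>p. dent (1/2) (real ` D p)) w 0"
    by (elim exE conjE)
  have "word_eval G i (positive_word n z) \<in> W \<longleftrightarrow> (\<forall>j<n. z j \<in> B j)"
    if z: "z \<in> {..<n} \<rightarrow>\<^sub>E topspace X" for z
  proof -
    let ?t = "word_eval order_aut (\<lambda>p. dent (1/2) (real ` D p)) (positive_word n z) 0"
    \<comment> \<open>This bound turns the open condition \<open>real n \<le> ?t\<close> into an
      equality.\<close>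
    have "?t \<le> real n"
      using dent_le fin by (intro orbit_positive_word_le) blast
    then have "word_eval G i (positive_word n z) \<in> W \<longleftrightarrow> ?t = real n"
      using bspec[OF iff positive_word_in_lists[OF z]] by linarith
    also have "\<dots> \<longleftrightarrow> (\<forall>j<n. j \<notin> D (z j))"
      using fin by (rule orbit_positive_word_eq_iff)
    finally show ?thesis
      by (auto simp: D_def)
  qed
  with W show ?thesis by blast
qed

lemma nonpositive_open_set:
  assumes free: "free_paratopological_group X G T i" and t1: "t1_space X"
    and w: "w \<in> lists (topspace X \<times> UNIV)" "reduced w"
    and nonpos: "\<not> (length w = n \<and> (\<forall>l \<in> set w. snd l))"
  shows "\<exists>W. openin T W \<and> word_eval G i w \<in> W \<and>
    (\<forall>z \<in> {..<n} \<rightarrow>\<^sub>E topspace X. word_eval G i (positive_word n z) \<notin> W)"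
proof -
  \<comment> \<open>It suffices to find a continuous \<open>f\<close> for which \<open>w\<close>
    moves \<open>0\<close> strictly beyond every positive word of length \<open>n\<close>.\<close>
  have *: ?thesis if f: "continuous_map X order_aut_topology f"
    and less: "\<And>z. word_eval order_aut f (positive_word n z) 0 < word_eval order_aut f w (0::real)" for f
  proof -
    from orbit_open_set[OF free f, of "word_eval order_aut f w 0"]
    obtain W where W: "openin T W" and iff: "\<forall>v \<in> lists (topspace X \<times> UNIV).
        word_eval G i v \<in> W \<longleftrightarrow> word_eval order_aut f w 0 \<le> word_eval order_aut f v 0"
      by (elim exE conjE)
    have "word_eval G i (positive_word n z) \<notin> W" if "z \<in> {..<n} \<rightarrow>\<^sub>E topspace X" for z
      using bspec[OF iff positive_word_in_lists[OF that]] less[of z] by linarith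
    then show ?thesis
      using W bspec[OF iff w(1)] by blast
  qed
  show ?thesis
  proof (cases "level 0 w = real n")
    case False
    \<comment> \<open>The direction in which the exponent sum of \<open>w\<close> lies beyond
      \<open>n\<close>: the orbits end at \<open>c * level 0 w\<close> and
      \<open>c * n\<close>.\<close>
    define c :: real where "c = (if level 0 w > real n then 1 else - 1)"
    have "(\<lambda>r. r + c) \<in> carrier order_aut"
      by (auto simp: strict_mono_def intro!: surjI[of _ "\<lambda>y. y - c"])
    then have "continuous_map X order_aut_topology (\<lambda>_ r. r + c)"
      by (simp add: topspace_order_aut)
    then show ?thesis
      using False by (intro *[of "\<lambda>_ r. r + c"])
        (auto simp: orbit_translation level_positive_word c_def)
  next
    case True
    have "nneg w \<noteq> 0"
    proof
      assume 0: "nneg w = 0"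
      then have all: "\<forall>l \<in> set w. snd l"
        by (auto simp: nneg_def filter_empty_conv)
      then have "npos w = length w"
        by (simp add: npos_def)
      then show False
        using 0 True nonpos all by (simp add: level_def)
    qed
    \<comment> \<open>The largest depth for which the levels stay separated by
      \<open>level_separated\<close>.\<close>
    define e where "e = 1 / real (length w + 2)"
    have e: "e > 0" "e * real (length w + 2) \<le> 1"
      by (simp_all add: e_def)
    let ?f = "\<lambda>a. dent e (descents e w a)"
    have "continuous_map X order_aut_topology ?f"
    proof (rule continuous_map_dent)
      show "finite (\<Union>a \<in> fst ` set w. descents e w a)"
        by (simp add: finite_descents)
      have emp: "descents e w p = {}" if "p \<notin> fst ` set w" for p
        using that by (force simp: descents_def)
      then show "descents e w p \<subseteq> (\<Union>a \<in> fst ` set w. descents e w a)" for p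
        by (cases "p \<in> fst ` set w") auto
      show "openin X {p \<in> topspace X. s \<notin> descents e w p}" for s
      proof -
        let ?F = "{p \<in> topspace X. s \<in> descents e w p}"
        have "?F \<subseteq> fst ` set w" using emp by blast
        \<comment> \<open>Only the finitely many letters of \<open>w\<close> carry dents, and finite
          sets are closed in a \<open>T1\<close> space.\<close>
        then have "finite ?F" using finite_subset by blast
        then have "closedin X ?F"
          using t1 by (auto simp: t1_space_closedin_finite)
        moreover have "{p \<in> topspace X. s \<notin> descents e w p} = topspace X - ?F" by blast
        ultimately show ?thesis by auto
      qed
    qed
    moreover have "word_eval order_aut ?f (positive_word n z) 0 < word_eval order_aut ?f w 0" for z
    proof -
      have "word_eval order_aut ?f (positive_word n z) 0 \<le> real n"
        by (rule orbit_positive_word_le) (rule dent_le[OF finite_descents])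
      \<comment> \<open>Here \<open>level e w\<close> is \<open>n + e * nneg w\<close>, and there is
        at least one inverse letter.\<close>
      also have "real n < level e w"
        using True e(1) \<open>nneg w \<noteq> 0\<close> by (simp add: level_def)
      also have "level e w = word_eval order_aut ?f w 0"
        by (rule orbit_reduced_word[OF w(2) e append_Nil[symmetric], symmetric])
      finally show ?thesis .
    qed
    ultimately show ?thesis by (rule *[of ?f])
  qed
qed

section \<open>The embedding of the power and the closedness of its image\<close>

lemma continuous_map_positive_word:
  assumes "paratopological_group G T" "continuous_map X T i" "k \<le> n"
  shows "continuous_map (product_topology (\<lambda>_. X) {..<n}) T (\<lambda>z. word_eval G i (positive_word k z))"
  using assms(3)
proof (induction k)
  case 0
  interpret paratopological_group G T by fact
  show ?case by (simp add: topspace_eq)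
next
  case (Suc k)
  interpret paratopological_group G T by fact
  let ?P = "product_topology (\<lambda>_. X) {..<n}"
  have "continuous_map ?P X (\<lambda>z. z k)"
    using Suc.prems by (intro continuous_map_product_projection) auto
  then have "continuous_map ?P T (\<lambda>z. i (z k))"
    using continuous_map_compose[OF _ assms(2)] by (fastforce simp: o_def)
  then have "continuous_map ?P (prod_topology T T) (\<lambda>z. (i (z k), word_eval G i (positive_word k z)))"
    using Suc by (intro continuous_map_pairedI) auto
  from continuous_map_compose[OF this continuous_mult] show ?case
    by (simp add: o_def)
qed

theorem theorem4p10:
  fixes X :: "'a topology" and G :: "('g, 'm) monoid_scheme"
    and T :: "'g topology" and i :: "'a \<Rightarrow> 'g" and n :: nat
  assumes "t1_space X"
    and "free_paratopological_group X G T i"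
    and "n \<ge> 1"
  shows "\<exists>C. closedin T C \<and>
           product_topology (\<lambda>_. X) {..<n} homeomorphic_space subtopology T C"
proof -
  note free = assms(2)
  interpret paratopological_group G T
    using free by (simp add: free_paratopological_group_def)
  have i: "continuous_map X T i"
    using free by (rule free_group_continuous)
  have iG: "i ` topspace X \<subseteq> carrier G"
    using continuous_map_image_subset_topspace[OF i] topspace_eq by simp
  let ?P = "product_topology (\<lambda>_. X) {..<n}"
  let ?E = "{..<n} \<rightarrow>\<^sub>E topspace X"
  define \<phi> where "\<phi> z = word_eval G i (positive_word n z)" for z
  define C where "C = \<phi> ` ?E"
  have top: "topspace ?P = ?E" by simp
  have cont: "continuous_map ?P T \<phi>"
    unfolding \<phi>_def using continuous_map_positive_word[OF paratopological_group_axioms i order_refl] .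
  have CT: "C \<subseteq> topspace T"
    using continuous_map_image_subset_topspace[OF cont] by (simp add: C_def)
  have box: "\<exists>W. openin T W \<and> (\<forall>z \<in> ?E. \<phi> z \<in> W \<longleftrightarrow> (\<forall>j<n. z j \<in> B j))"
    if "\<And>j. j < n \<Longrightarrow> openin X (B j)" for B
    unfolding \<phi>_def using free that by (rule box_open_set)
  have "inj_on \<phi> (topspace ?P)"
    unfolding top
  proof (rule inj_onI, rule ccontr)
    fix y z assume yz: "y \<in> ?E" "z \<in> ?E" "\<phi> y = \<phi> z" "y \<noteq> z"
    then obtain j where j: "j < n" "y j \<noteq> z j"
      by (metis PiE_ext lessThan_iff)
    then have "y j \<in> topspace X" "z j \<in> topspace X"
      using PiE_mem[OF yz(1), of j] PiE_mem[OF yz(2), of j] by simp_all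
    then obtain U where U: "openin X U" "y j \<in> U" "z j \<notin> U"
      using assms(1) j unfolding t1_space_def by blast
    \<comment> \<open>Constraining the coordinate \<open>j\<close> alone gives a box that contains
      \<open>y\<close> but not \<open>z\<close>.\<close>
    define B where "B k = (if k = j then U else topspace X)" for k
    have "openin X (B k)" for k
      using U(1) by (simp add: B_def)
    then obtain W where W: "\<forall>z \<in> ?E. \<phi> z \<in> W \<longleftrightarrow> (\<forall>j<n. z j \<in> B j)"
      using box[of B] by blast
    have "y k \<in> B k" if "k < n" for k
      using PiE_mem[OF yz(1), of k] U(2) that by (simp add: B_def)
    then have "\<phi> y \<in> W"
      using bspec[OF W yz(1)] by blast
    moreover have "z j \<notin> B j"
      using U(3) by (simp add: B_def)
    then have "\<phi> z \<notin> W"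
      using bspec[OF W yz(2)] j(1) by blast
    ultimately show False using yz(3) by simp
  qed
  moreover have "open_map ?P (subtopology T C) \<phi>"
    unfolding open_map_def
  proof (intro allI impI, subst openin_subopen, intro ballI)
    fix V g assume V: "openin ?P V" and "g \<in> \<phi> ` V"
    then obtain y where y: "y \<in> V" "g = \<phi> y" by auto
    then obtain B where B: "\<forall>j \<in> {..<n}. openin X (B j)" "y \<in> Pi\<^sub>E {..<n} B" "Pi\<^sub>E {..<n} B \<subseteq> V"
      using V unfolding openin_product_topology_alt by blast
    \<comment> \<open>\<open>W\<close> meets \<open>C\<close> exactly in the image of the box, so
      \<open>W \<inter> C\<close> is a neighbourhood of \<open>g\<close> inside the image of
      \<open>V\<close>.\<close>
    then obtain W where W: "openin T W" "\<forall>z \<in> ?E. \<phi> z \<in> W \<longleftrightarrow> (\<forall>j<n. z j \<in> B j)"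
      using box[of B] B(1) by (metis lessThan_iff)
    have yE: "y \<in> ?E"
      using openin_subset[OF V] y(1) unfolding top by blast
    have "y j \<in> B j" if "j < n" for j
      by (rule PiE_mem[OF B(2)]) (simp add: that)
    then have "\<phi> y \<in> W"
      using bspec[OF W(2) yE] by blast
    then have "g \<in> W \<inter> C"
      using yE y(2) by (simp add: C_def)
    moreover have "W \<inter> C \<subseteq> \<phi> ` V"
    proof
      fix k assume "k \<in> W \<inter> C"
      then obtain z where z: "z \<in> ?E" "k = \<phi> z" "\<phi> z \<in> W"
        unfolding C_def by blast
      then have "\<forall>j<n. z j \<in> B j"
        using W(2) by blast
      then have "z \<in> Pi\<^sub>E {..<n} B"
        using z(1) by (simp add: PiE_iff)
      then show "k \<in> \<phi> ` V" using z(2) B(3) by blast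
    qed
    ultimately show "\<exists>W. openin (subtopology T C) W \<and> g \<in> W \<and> W \<subseteq> \<phi> ` V"
      using W(1) by (intro exI[of _ "W \<inter> C"]) (auto simp: openin_subtopology)
  qed
  ultimately have "embedding_map ?P (subtopology T C) \<phi>"
    using cont by (intro injective_open_imp_embedding_map)
      (auto simp: continuous_map_in_subtopology C_def)
  then have "homeomorphic_map ?P (subtopology (subtopology T C) (\<phi> ` topspace ?P)) \<phi>"
    by (simp add: embedding_map_def)
  then have "?P homeomorphic_space subtopology T C"
    by (simp add: subtopology_subtopology C_def[symmetric] homeomorphic_map_imp_homeomorphic_space)
  moreover have "closedin T C"
    unfolding closedin_def
  proof (intro conjI CT, subst openin_subopen, intro ballI)
    fix g assume g: "g \<in> topspace T - C"
    then have "g \<in> generate G (i ` topspace X)"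
      using free topspace_eq by (simp add: free_paratopological_group_def)
    then obtain w where w: "w \<in> lists (topspace X \<times> UNIV)" "word_eval G i w = g" "reduced w"
      by (rule generate_imp_reduced_word[OF iG])
    \<comment> \<open>A positive word of length \<open>n\<close> would put \<open>g\<close> into
      \<open>C\<close>.\<close>
    have "\<not> (length w = n \<and> (\<forall>l \<in> set w. snd l))"
    proof
      assume pos: "length w = n \<and> (\<forall>l \<in> set w. snd l)"
      then obtain z where "z \<in> ?E" "w = positive_word n z"
        using all_positive_imp_positive_word[OF _ w(1)] by blast
      then have "g \<in> C"
        using w(2) unfolding C_def \<phi>_def by blast
      then show False using g by simp
    qed
    from nonpositive_open_set[OF free assms(1) w(1,3) this] w(2)
    obtain W where W: "openin T W" "g \<in> W" "\<forall>z \<in> ?E. \<phi> z \<notin> W"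
      unfolding \<phi>_def by blast
    then have "W \<subseteq> topspace T - C"
      using openin_subset[OF W(1)] unfolding C_def by blast
    with W(1,2) show "\<exists>W. openin T W \<and> g \<in> W \<and> W \<subseteq> topspace T - C"
      by blast
  qed
  ultimately show ?thesis by blast
qed

end
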